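(* Let $a=(a_k)_{k=1}^n$ and $b=(b_k)_{k=1}^n$ be finite sequences of non-negative real numbers, each in non-decreasing order, such that $b\prec_w a$, and suppose that $$\sum_{k=1}^n b_k=\sum_{k=1}^n a_k\qquad\text{and}\qquad\sum_{k=1}^n b_k^2=\sum_{k=1}^n a_k^2.$$ Then $a=b$.
   Context: Weak supermajorisation: for sequences in non-decreasing order, $b\prec_w a$ means $\sum_{k=1}^m a_k\le\sum_{k=1}^m b_k$ for all $m\in\{1,\ldots,n\}$. *)

theory Defs
  imports Complex_Main
begin

text \<open>
  A finite sequence \<open>(x\<^sub>1, \<dots>, x\<^sub>n)\<close> of reals is represented by a function \<open>nat \<Rightarrow> real\<close>
  of which only the values on \<open>{1..n}\<close> are relevant.
\<close>

text \<open>
  \<open>weakly_supermajorised n b a\<close> is the relation \<open>b \<prec>\<^sub>w a\<close>. The partial sums of the sequences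
  as they are given express weak supermajorisation only if both sequences are in
  non-decreasing order; for other sequences one would have to rearrange first.
  Note the direction: the larger partial sums are those of \<open>b\<close>.
\<close>

definition weakly_supermajorised :: "nat \<Rightarrow> (nat \<Rightarrow> real) \<Rightarrow> (nat \<Rightarrow> real) \<Rightarrow> bool" where
  "weakly_supermajorised n b a \<longleftrightarrow> (\<forall>m\<in>{1..n}. (\<Sum>k=1..m. a k) \<le> (\<Sum>k=1..m. b k))"

end

theory Submission
  imports Defs
begin

text \<open>
  The quantity to control is \<open>\<Sum>(a\<^sub>k - b\<^sub>k)\<^sup>2 = \<Sum>a\<^sub>k\<^sup>2 + \<Sum>b\<^sub>k\<^sup>2 - 2\<Sum>a\<^sub>kb\<^sub>k\<close>. As the sums of squares agree,
  it equals \<open>2\<Sum>b\<^sub>k(b\<^sub>k - a\<^sub>k)\<close>. The differences \<open>b\<^sub>k - a\<^sub>k\<close> have non-negative partial sums and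
  total \<open>0\<close>, so they carry their positive mass early, where the non-decreasing weights \<open>b\<^sub>k\<close> are
  small; summation by parts (\<open>sum_mult_le_last_mult_sum\<close>) turns this into
  \<open>\<Sum>b\<^sub>k(b\<^sub>k - a\<^sub>k) \<le> 0\<close>. Hence the sum of squares \<open>\<Sum>(a\<^sub>k - b\<^sub>k)\<^sup>2\<close> vanishes, and so does each term.
\<close>

text \<open>
  One-sided Abel summation: with \<open>D\<^sub>m\<close> the partial sums of \<open>d\<close>, the right-hand side exceeds the
  left-hand side by \<open>\<Sum>m<n. D\<^sub>m (c\<^sub>m\<^sub>+\<^sub>1 - c\<^sub>m)\<close>, where no term is negative. Each induction step adds
  one of these terms.
\<close>

lemma sum_mult_le_last_mult_sum:
  fixes c d :: "nat \<Rightarrow> 'a::linordered_idom"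
  assumes "mono_on {1..n} c"
    and "\<And>m. m \<in> {1..n} \<Longrightarrow> 0 \<le> (\<Sum>k=1..m. d k)"
  shows "(\<Sum>k=1..n. c k * d k) \<le> c n * (\<Sum>k=1..n. d k)"
  using assms
proof (induction n)
  case 0
  then show ?case by simp
next
  case (Suc n)
  have "mono_on {1..n} c"
    using Suc.prems(1) by (rule mono_on_subset) auto
  then have IH: "(\<Sum>k=1..n. c k * d k) \<le> c n * (\<Sum>k=1..n. d k)"
    using Suc.IH Suc.prems(2) by simp
  have "c n * (\<Sum>k=1..n. d k) \<le> c (Suc n) * (\<Sum>k=1..n. d k)"
  proof (cases "n = 0")
    case False
    then have "c n \<le> c (Suc n)"
      by (intro mono_onD[OF Suc.prems(1)]) auto
    moreover have "0 \<le> (\<Sum>k=1..n. d k)"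
      using False by (intro Suc.prems(2)) auto
    ultimately show ?thesis by (rule mult_right_mono)
  qed simp
  with IH show ?case by (simp add: distrib_left)
qed

theorem proposition4p2:
  fixes n :: nat and a b :: "nat \<Rightarrow> real"
  assumes "\<And>k. k \<in> {1..n} \<Longrightarrow> 0 \<le> a k"
    and "\<And>k. k \<in> {1..n} \<Longrightarrow> 0 \<le> b k"
    and "mono_on {1..n} a"
    and "mono_on {1..n} b"
    and "weakly_supermajorised n b a"
    and "(\<Sum>k=1..n. b k) = (\<Sum>k=1..n. a k)"
    and "(\<Sum>k=1..n. (b k)\<^sup>2) = (\<Sum>k=1..n. (a k)\<^sup>2)"
  shows "\<forall>k\<in>{1..n}. a k = b k"
proof -
  have "(\<Sum>k=1..n. b k * (b k - a k)) \<le> b n * (\<Sum>k=1..n. b k - a k)"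
    using assms(4,5)
    by (intro sum_mult_le_last_mult_sum)
      (auto simp: weakly_supermajorised_def sum_subtractf)
  also have "\<dots> = 0"
    using assms(6) by (simp add: sum_subtractf)
  finally have weighted: "(\<Sum>k=1..n. b k * (b k - a k)) \<le> 0" .
  have "(\<Sum>k=1..n. (a k - b k)\<^sup>2)
      = (\<Sum>k=1..n. ((a k)\<^sup>2 - (b k)\<^sup>2) + 2 * (b k * (b k - a k)))"
    by (intro sum.cong) (auto simp: power2_eq_square algebra_simps)
  also have "\<dots> = 2 * (\<Sum>k=1..n. b k * (b k - a k))"
    using assms(7) by (simp add: sum.distrib sum_subtractf sum_distrib_left)
  finally have "(\<Sum>k=1..n. (a k - b k)\<^sup>2) \<le> 0"
    using weighted by simp
  then have "(\<Sum>k=1..n. (a k - b k)\<^sup>2) = 0"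
    by (intro antisym sum_nonneg) auto
  then show ?thesis
    by (simp add: sum_nonneg_eq_0_iff)
qed

end
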